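(* For the dynamic product line design problem described in the context, the myopic policy generates expected revenues over $T$ sales epochs within a factor of $2$ of (i.e. at least one half of) those of the optimal adaptive policy.
   Context: Dynamic product line design. A firm can offer products from a finite set $\mathcal P$; at each sales epoch $t=0,1,\dots,T-1$ it must offer a subset $A\subset\mathcal P$ with $|A|\le k$. There are $I$ consumer segments and $x_{t,i}\in\mathbb Z_+$ denotes the size of segment $i$ in epoch $t$ (observed by the firm). If the product line offered at time $t$ is $A$, each consumer of segment $i$ present in the market at time $t$ purchases a product in $A$ with probability $P_{t,i}(A)\in[0,1]$, independently of other consumers and of the past given these probabilities. Each such sale garners the firm revenue $p_i\ge0$ and the consumer is lost to the system. Thus the number of sales $X_{t,i}$ to segment $i$ is $\mathrm{Binomial}(x_{t,i},P_{t,i}(A))$, $x_{t+1,i}=x_{t,i}-X_{t,i}$, and revenue $\sum_ip_iX_{t,i}$ is earned in epoch $t$. The processes $P_{t,i}(A)$ are arbitrary exogenous stochastic processes whose current values are known at time $t$ and whose dynamics are known to the firm. An adaptive policy chooses $A$ at time $t$ based on the information available up to time $t$. The myopic policy chooses at each time $t$ a set $A\subset\mathcal P$, $|A|\le k$, maximizing the expected revenue $\sum_ip_i\,x_{t,i}\,P_{t,i}(A)$ of the current epoch. *)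

theory Defs
  imports "HOL-Probability.Probability"
begin

record ('w, 'a, 's) product_line =
  exo :: "'w measure"
  info :: "nat \<Rightarrow> 'w measure"
  horizon :: nat
  products :: "'a set"
  cap :: nat
  segments :: "'s set"
  init_size :: "'s \<Rightarrow> nat"
  price :: "'s \<Rightarrow> real"
  purchase_prob :: "nat \<Rightarrow> 's \<Rightarrow> 'a set \<Rightarrow> 'w \<Rightarrow> real"

definition assortments :: "('w, 'a, 's) product_line \<Rightarrow> 'a set set" where
  "assortments D = {A. A \<subseteq> products D \<and> card A \<le> cap D}"

text \<open>
  The probability space \<open>exo D\<close> carries only the exogenous randomness; \<open>info D t\<close> is the exogenous
  information available at time \<open>t\<close>.  No assumption is made on the purchase probabilities beyond
  their being adapted.
\<close>

definition product_line_problem :: "('w, 'a, 's) product_line \<Rightarrow> bool" where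
  "product_line_problem D \<longleftrightarrow>
     prob_space (exo D) \<and>
     filtration (space (exo D)) (info D) \<and>
     (\<forall>t. subalgebra (exo D) (info D t)) \<and>
     finite (products D) \<and>
     finite (segments D) \<and>
     (\<forall>i\<in>segments D. 0 \<le> price D i) \<and>
     (\<forall>t<horizon D. \<forall>i\<in>segments D. \<forall>A\<in>assortments D.
        purchase_prob D t i A \<in> borel_measurable (info D t) \<and>
        (\<forall>\<omega>\<in>space (exo D). purchase_prob D t i A \<omega> \<in> {0..1}))"

text \<open>
  A history lists, in chronological order, the assortments offered so far together with the
  resulting sales vectors.  The subtraction below never truncates along a history of positive
  probability, because sales never exceed the current size.
\<close>

type_synonym ('a, 's) history = "('a set \<times> ('s \<Rightarrow> nat)) list"

definition size_after :: "('w, 'a, 's) product_line \<Rightarrow> ('a, 's) history \<Rightarrow> 's \<Rightarrow> nat" where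
  "size_after D h = fold (\<lambda>(A, X) x. (\<lambda>i. x i - X i)) h (init_size D)"

definition revenue :: "('w, 'a, 's) product_line \<Rightarrow> ('a, 's) history \<Rightarrow> real" where
  "revenue D h = (\<Sum>(A, X)\<leftarrow>h. \<Sum>i\<in>segments D. price D i * real (X i))"

text \<open>
  A policy chooses the assortment at time \<open>t\<close> from the history and, through \<open>\<omega>\<close>, the exogenous
  information; measurability with respect to \<open>info D t\<close> makes it non-anticipative, and
  the target space \<open>count_space (assortments D)\<close> makes it feasible.  Randomised policies are covered
  since \<open>exo D\<close> and \<open>info D\<close> may carry further randomness.
\<close>

type_synonym ('w, 'a, 's) policy = "nat \<Rightarrow> ('a, 's) history \<Rightarrow> 'w \<Rightarrow> 'a set"

definition adaptive_policy :: "('w, 'a, 's) product_line \<Rightarrow> ('w, 'a, 's) policy \<Rightarrow> bool" where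
  "adaptive_policy D \<sigma> \<longleftrightarrow>
     (\<forall>t<horizon D. \<forall>h. \<sigma> t h \<in> info D t \<rightarrow>\<^sub>M count_space (assortments D))"

definition sales_pmf ::
  "('w, 'a, 's) product_line \<Rightarrow> 'w \<Rightarrow> nat \<Rightarrow> 'a set \<Rightarrow> ('s \<Rightarrow> nat) \<Rightarrow> ('s \<Rightarrow> nat) pmf" where
  "sales_pmf D \<omega> t A x =
     Pi_pmf (segments D) 0 (\<lambda>i. binomial_pmf (x i) (purchase_prob D t i A \<omega>))"

text \<open>
  Conditional law, given the exogenous outcome \<open>\<omega>\<close>, of the history of epochs \<open>0, \<dots>, t - 1\<close>.
  Conditioning on the whole of \<open>\<omega>\<close> expresses that the purchase probabilities are exogenous: given
  them, purchases are independent of everything else.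
\<close>

primrec history_pmf ::
  "('w, 'a, 's) product_line \<Rightarrow> ('w, 'a, 's) policy \<Rightarrow> 'w \<Rightarrow> nat \<Rightarrow> ('a, 's) history pmf" where
  "history_pmf D \<sigma> \<omega> 0 = return_pmf []"
| "history_pmf D \<sigma> \<omega> (Suc t) =
     bind_pmf (history_pmf D \<sigma> \<omega> t) (\<lambda>h.
       map_pmf (\<lambda>X. h @ [(\<sigma> t h \<omega>, X)])
         (sales_pmf D \<omega> t (\<sigma> t h \<omega>) (size_after D h)))"

definition expected_revenue ::
  "('w, 'a, 's) product_line \<Rightarrow> ('w, 'a, 's) policy \<Rightarrow> real" where
  "expected_revenue D \<sigma> =
     (LINT \<omega>|exo D. measure_pmf.expectation (history_pmf D \<sigma> \<omega> (horizon D)) (revenue D))"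

text \<open>
  The supremum is over a nonempty set bounded above by
  \<open>\<Sum>i\<in>segments D. price D i * init_size D i\<close>.
\<close>

definition optimal_revenue :: "('w, 'a, 's) product_line \<Rightarrow> real" where
  "optimal_revenue D = (SUP \<sigma>\<in>{\<sigma>. adaptive_policy D \<sigma>}. expected_revenue D \<sigma>)"

text \<open>
  Ties are broken arbitrarily, and nothing is required at histories the policy never reaches.
\<close>

definition myopic_policy :: "('w, 'a, 's) product_line \<Rightarrow> ('w, 'a, 's) policy \<Rightarrow> bool" where
  "myopic_policy D \<sigma> \<longleftrightarrow>
     adaptive_policy D \<sigma> \<and>
     (\<forall>t<horizon D. \<forall>\<omega>\<in>space (exo D). \<forall>h\<in>set_pmf (history_pmf D \<sigma> \<omega> t).
        is_arg_max
          (\<lambda>A. \<Sum>i\<in>segments D. price D i * real (size_after D h i) * purchase_prob D t i A \<omega>)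
          (\<lambda>A. A \<in> assortments D) (\<sigma> t h \<omega>))"

end

theory Submission
  imports Defs
begin

text \<open>
  The bound holds at every fixed exogenous outcome \<open>\<omega>\<close>, even against a clairvoyant who knows the whole
  path of purchase probabilities.  Let \<open>V n x\<close> be the clairvoyant's optimal expected revenue with \<open>n\<close>
  epochs left and segment sizes \<open>x\<close>.  Coupling the purchases of two systems that differ by one consumer
  of segment \<open>j\<close> shows that this consumer raises \<open>V n\<close> by an amount between \<open>0\<close> and \<open>price D j\<close>
  (\<open>clairvoyant_value_add_one\<close>).  Hence sales \<open>X\<close> lower \<open>V n\<close> by an amount between \<open>0\<close> and their own
  revenue \<open>r X\<close>.  If \<open>A\<close> is the myopic and \<open>B\<close> the clairvoyant's assortment at \<open>x\<close>, with sales
  \<open>X\<^sub>A\<close> and \<open>X\<^sub>B\<close>, then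
  \<open>V (Suc n) x = E (r X\<^sub>B + V n (x - X\<^sub>B)) \<le> E (r X\<^sub>B) + V n x \<le> E (r X\<^sub>A) + V n x
    \<le> E (2 * r X\<^sub>A + V n (x - X\<^sub>A))\<close>
  (\<open>clairvoyant_value_le_myopic_step\<close>).

  Consequently, along the myopic policy, the expectation of twice the revenue so far plus the value
  \<open>V\<close> of the remaining epochs is nondecreasing in time, whereas for every adaptive policy the
  expectation of the revenue so far plus that value is nonincreasing.  Comparing the first and the last
  epoch bounds the expected revenue of any adaptive policy by \<open>V\<close> at the start, and this in turn
  by twice the expected myopic revenue.  It remains to integrate over \<open>\<omega>\<close>.  A Bochner integral of a
  nonintegrable function would be \<open>0\<close>, so that integrability of the conditional expected revenue is
  needed; it follows from measurability and a uniform bound.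
\<close>

section \<open>Finitely supported expectations\<close>

lemma expectation_bind_finite:
  fixes f :: "'b \<Rightarrow> real"
  assumes "finite (set_pmf p)" "\<And>x. x \<in> set_pmf p \<Longrightarrow> finite (set_pmf (K x))"
  shows "measure_pmf.expectation (bind_pmf p K) f =
    measure_pmf.expectation p (\<lambda>x. measure_pmf.expectation (K x) f)"
proof -
  have "measure_pmf.expectation (bind_pmf p K) f =
      (\<Sum>x\<in>set_pmf p. pmf p x *\<^sub>R measure_pmf.expectation (K x) f)"
    using assms by (intro pmf_expectation_bind) auto
  also have "\<dots> = measure_pmf.expectation p (\<lambda>x. measure_pmf.expectation (K x) f)"
    using assms by (intro integral_measure_pmf[symmetric]) auto
  finally show ?thesis .
qed

lemma expectation_mono_finite:
  fixes f g :: "'b \<Rightarrow> real"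
  assumes "finite (set_pmf p)" "\<And>x. x \<in> set_pmf p \<Longrightarrow> f x \<le> g x"
  shows "measure_pmf.expectation p f \<le> measure_pmf.expectation p g"
  using assms by (intro integral_mono_AE) (auto simp: integrable_measure_pmf_finite AE_measure_pmf_iff)

lemma expectation_cong_pmf:
  fixes f g :: "'b \<Rightarrow> real"
  assumes "\<And>x. x \<in> set_pmf p \<Longrightarrow> f x = g x"
  shows "measure_pmf.expectation p f = measure_pmf.expectation p g"
  using assms by (intro integral_cong_AE) (auto simp: AE_measure_pmf_iff)

lemma set_pmf_binomial_subset: "q \<in> {0..1} \<Longrightarrow> set_pmf (binomial_pmf n q) \<subseteq> {..n}"
  by (auto simp: set_pmf_binomial_eq split: if_splits)

lemma expectation_binomial:
  assumes q: "q \<in> {0..1}"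
  shows "measure_pmf.expectation (binomial_pmf n q) real = real n * q"
proof (induction n)
  case 0
  then show ?case using q by (simp add: binomial_pmf_0)
next
  case (Suc n)
  have fin: "finite (set_pmf (binomial_pmf n q))"
    using q by (rule finite_set_pmf_binomial_pmf)
  have "measure_pmf.expectation (binomial_pmf (Suc n) q) real =
      measure_pmf.expectation (bernoulli_pmf q)
        (\<lambda>b. measure_pmf.expectation (map_pmf (\<lambda>k. (if b then 1 else 0) + k) (binomial_pmf n q)) real)"
    unfolding binomial_pmf_Suc[OF q] map_pmf_def
    by (subst expectation_bind_finite) (use fin in auto)
  also have "\<dots> = measure_pmf.expectation (bernoulli_pmf q)
      (\<lambda>b. (if b then 1 else 0) + real n * q)"
    using fin Suc by (intro expectation_cong_pmf) (auto simp: integrable_measure_pmf_finite)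
  also have "\<dots> = real (Suc n) * q"
    using q by (subst integral_bernoulli_pmf) (auto simp: algebra_simps)
  finally show ?case .
qed

text \<open>
  One more consumer in segment \<open>j\<close> adds an independent Bernoulli sale there.
\<close>

lemma Pi_binomial_Suc:
  assumes S: "finite S" "j \<in> S" and q: "q j \<in> {0..1}"
  shows "Pi_pmf S 0 (\<lambda>i. binomial_pmf ((x(j := Suc (x j))) i) (q i)) =
    bind_pmf (bernoulli_pmf (q j)) (\<lambda>b.
      map_pmf (\<lambda>X. X(j := (if b then 1 else 0) + X j))
        (Pi_pmf S 0 (\<lambda>i. binomial_pmf (x i) (q i))))"
proof -
  define R where "R = S - {j}"
  have R: "finite R" "j \<notin> R" "S = insert j R" using S by (auto simp: R_def)
  have eq: "Pi_pmf R 0 (\<lambda>i. binomial_pmf ((x(j := Suc (x j))) i) (q i)) =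
      Pi_pmf R 0 (\<lambda>i. binomial_pmf (x i) (q i))"
    using R by (intro Pi_pmf_cong) auto
  show ?thesis
    unfolding R(3) Pi_pmf_insert'[OF R(1,2)] eq
    by (simp add: binomial_pmf_Suc[OF q] map_pmf_def bind_assoc_pmf bind_return_pmf)
qed

section \<open>Sales, revenue and sizes along a history\<close>

text \<open>
  Revenue of a single epoch with sales vector \<open>X\<close>; for a size vector in place of \<open>X\<close>, the revenue from
  selling to every remaining consumer.
\<close>

definition sales_value :: "('w, 'a, 's) product_line \<Rightarrow> ('s \<Rightarrow> nat) \<Rightarrow> real" where
  "sales_value D X = (\<Sum>i\<in>segments D. price D i * real (X i))"

lemma revenue_Nil [simp]: "revenue D [] = 0"
  by (simp add: revenue_def)

lemma revenue_snoc [simp]: "revenue D (h @ [(A, X)]) = revenue D h + sales_value D X"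
  by (simp add: revenue_def sales_value_def)

lemma size_after_Nil [simp]: "size_after D [] = init_size D"
  by (simp add: size_after_def)

lemma size_after_snoc [simp]: "size_after D (h @ [(A, X)]) = (\<lambda>i. size_after D h i - X i)"
  by (simp add: size_after_def)

lemma finite_segments:
  assumes D: "product_line_problem D"
  shows "finite (segments D)"
  using D by (simp add: product_line_problem_def)

lemma price_nonneg:
  assumes "product_line_problem D" and "i \<in> segments D"
  shows "0 \<le> price D i"
  using assms by (simp add: product_line_problem_def)

lemma purchase_prob_range:
  assumes D: "product_line_problem D"
    and "t < horizon D" "A \<in> assortments D" "\<omega> \<in> space (exo D)" "i \<in> segments D"
  shows "purchase_prob D t i A \<omega> \<in> {0..1}"
  using assms unfolding product_line_problem_def by blast

lemma finite_assortments:
  assumes D: "product_line_problem D"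
  shows "finite (assortments D)"
  using D by (simp add: product_line_problem_def assortments_def)

lemma assortments_nonempty: "assortments D \<noteq> {}"
  by (auto simp: assortments_def intro!: exI[of _ "{}"])

lemma sales_value_nonneg:
  assumes D: "product_line_problem D"
  shows "0 \<le> sales_value D X"
  unfolding sales_value_def by (intro sum_nonneg mult_nonneg_nonneg price_nonneg[OF D]) auto

lemma revenue_nonneg:
  assumes D: "product_line_problem D"
  shows "0 \<le> revenue D h"
  unfolding revenue_def
  by (intro sum_list_nonneg) (auto intro!: sum_nonneg mult_nonneg_nonneg price_nonneg[OF D])

lemma sales_value_upd:
  assumes D: "product_line_problem D" and j: "j \<in> segments D"
  shows "sales_value D (X(j := c)) = sales_value D X + price D j * (real c - real (X j))"
  unfolding sales_value_def using finite_segments[OF D] j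
  by (simp add: sum.remove algebra_simps)

lemma set_sales_subset:
  assumes D: "product_line_problem D" and t: "t < horizon D" and A: "A \<in> assortments D"
    and \<omega>: "\<omega> \<in> space (exo D)"
  shows "set_pmf (sales_pmf D \<omega> t A x) \<subseteq> PiE_dflt (segments D) 0 (\<lambda>i. {..x i})"
proof -
  have "set_pmf (sales_pmf D \<omega> t A x) \<subseteq>
      PiE_dflt (segments D) 0 (set_pmf \<circ> (\<lambda>i. binomial_pmf (x i) (purchase_prob D t i A \<omega>)))"
    unfolding sales_pmf_def by (rule set_Pi_pmf_subset'[OF finite_segments[OF D]])
  also have "\<dots> \<subseteq> PiE_dflt (segments D) 0 (\<lambda>i. {..x i})"
    using set_pmf_binomial_subset[OF purchase_prob_range[OF D t A \<omega>]]
    by (auto simp: PiE_dflt_def subset_eq)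
  finally show ?thesis .
qed

lemma sales_le:
  assumes D: "product_line_problem D" and t: "t < horizon D" and A: "A \<in> assortments D"
    and \<omega>: "\<omega> \<in> space (exo D)" and X: "X \<in> set_pmf (sales_pmf D \<omega> t A x)"
  shows "X i \<le> x i"
  using set_sales_subset[OF D t A \<omega>, of x] X by (cases "i \<in> segments D") (auto simp: PiE_dflt_def)

lemma sales_outside:
  assumes D: "product_line_problem D" and t: "t < horizon D" and A: "A \<in> assortments D"
    and \<omega>: "\<omega> \<in> space (exo D)" and X: "X \<in> set_pmf (sales_pmf D \<omega> t A x)"
    and i: "i \<notin> segments D"
  shows "X i = 0"
  using set_sales_subset[OF D t A \<omega>, of x] X i by (auto simp: PiE_dflt_def)

lemma finite_set_sales:
  assumes D: "product_line_problem D" and t: "t < horizon D" and A: "A \<in> assortments D"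
    and \<omega>: "\<omega> \<in> space (exo D)"
  shows "finite (set_pmf (sales_pmf D \<omega> t A x))"
  by (rule finite_subset[OF set_sales_subset[OF D t A \<omega>]])
    (intro finite_PiE_dflt finite_segments[OF D] finite_atMost)

lemma integrable_sales:
  assumes D: "product_line_problem D" and t: "t < horizon D" and A: "A \<in> assortments D"
    and \<omega>: "\<omega> \<in> space (exo D)"
  shows "integrable (measure_pmf (sales_pmf D \<omega> t A x)) (f :: _ \<Rightarrow> real)"
  by (rule integrable_measure_pmf_finite[OF finite_set_sales[OF D t A \<omega>]])

lemma expectation_sales_value:
  assumes D: "product_line_problem D" and t: "t < horizon D" and A: "A \<in> assortments D"
    and \<omega>: "\<omega> \<in> space (exo D)"
  shows "measure_pmf.expectation (sales_pmf D \<omega> t A x) (sales_value D) =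
    (\<Sum>i\<in>segments D. price D i * real (x i) * purchase_prob D t i A \<omega>)"
proof -
  have "measure_pmf.expectation (sales_pmf D \<omega> t A x) (\<lambda>X. real (X i)) =
      real (x i) * purchase_prob D t i A \<omega>" if i: "i \<in> segments D" for i
  proof -
    have "measure_pmf.expectation (sales_pmf D \<omega> t A x) (\<lambda>X. real (X i)) =
        measure_pmf.expectation (map_pmf (\<lambda>X. X i) (sales_pmf D \<omega> t A x)) real"
      by simp
    also have "\<dots> = real (x i) * purchase_prob D t i A \<omega>"
      unfolding sales_pmf_def using i
      by (simp add: Pi_pmf_component finite_segments[OF D]
          expectation_binomial[OF purchase_prob_range[OF D t A \<omega>]]
          del: integral_map_pmf)
    finally show ?thesis .
  qed
  then show ?thesis
    unfolding sales_value_def by (simp add: integrable_sales[OF D t A \<omega>] mult.assoc)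
qed

lemma expectation_sales_Suc:
  fixes f :: "('s \<Rightarrow> nat) \<Rightarrow> real"
  assumes D: "product_line_problem D" and t: "t < horizon D" and A: "A \<in> assortments D"
    and \<omega>: "\<omega> \<in> space (exo D)"
    and j: "j \<in> segments D"
  shows "measure_pmf.expectation (sales_pmf D \<omega> t A (x(j := Suc (x j)))) f =
    measure_pmf.expectation (sales_pmf D \<omega> t A x)
      (\<lambda>X. purchase_prob D t j A \<omega> * f (X(j := Suc (X j))) + (1 - purchase_prob D t j A \<omega>) * f X)"
proof -
  note q = purchase_prob_range[OF D t A \<omega> j]
  have "measure_pmf.expectation (sales_pmf D \<omega> t A (x(j := Suc (x j)))) f =
     measure_pmf.expectation (bernoulli_pmf (purchase_prob D t j A \<omega>)) (\<lambda>b.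
       measure_pmf.expectation (sales_pmf D \<omega> t A x) (\<lambda>X. f (X(j := (if b then 1 else 0) + X j))))"
    unfolding sales_pmf_def
      Pi_binomial_Suc[where q = "\<lambda>i. purchase_prob D t i A \<omega>", OF finite_segments[OF D] j q]
    unfolding sales_pmf_def[symmetric]
    by (subst expectation_bind_finite) (auto simp: finite_set_sales[OF D t A \<omega>])
  also have "\<dots> = measure_pmf.expectation (sales_pmf D \<omega> t A x)
      (\<lambda>X. purchase_prob D t j A \<omega> * f (X(j := Suc (X j))) + (1 - purchase_prob D t j A \<omega>) * f X)"
    using q by (subst integral_bernoulli_pmf) (auto simp: integrable_sales[OF D t A \<omega>] algebra_simps)
  finally show ?thesis .
qed

section \<open>The clairvoyant value function\<close>

text \<open>
  Value function, at a fixed exogenous outcome \<open>\<omega>\<close>, of a clairvoyant who knows all of \<open>\<omega>\<close> (but not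
  the future sales) and has \<open>n\<close> epochs left with segment sizes \<open>x\<close>.  The current epoch is then
  \<open>horizon D - n\<close>, which is meaningful for \<open>n \<le> horizon D\<close>.
\<close>

primrec clairvoyant_value ::
  "('w, 'a, 's) product_line \<Rightarrow> 'w \<Rightarrow> nat \<Rightarrow> ('s \<Rightarrow> nat) \<Rightarrow> real" where
  "clairvoyant_value D \<omega> 0 x = 0"
| "clairvoyant_value D \<omega> (Suc n) x =
     Max ((\<lambda>A. measure_pmf.expectation (sales_pmf D \<omega> (horizon D - Suc n) A x)
            (\<lambda>X. sales_value D X + clairvoyant_value D \<omega> n (\<lambda>i. x i - X i))) ` assortments D)"

text \<open>The two halves of the optimality equation, indexed by the epoch \<open>t\<close> instead of the epochs left.\<close>

lemma clairvoyant_value_ge: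
  assumes D: "product_line_problem D"
    and "t < horizon D" "A \<in> assortments D"
  shows "measure_pmf.expectation (sales_pmf D \<omega> t A x)
      (\<lambda>X. sales_value D X + clairvoyant_value D \<omega> (horizon D - Suc t) (\<lambda>i. x i - X i))
    \<le> clairvoyant_value D \<omega> (horizon D - t) x"
proof -
  have n: "horizon D - t = Suc (horizon D - Suc t)" "horizon D - Suc (horizon D - Suc t) = t"
    using assms by auto
  show ?thesis
    unfolding n(1) clairvoyant_value.simps n(2)
    using assms finite_assortments[OF D] by (intro Max_ge) auto
qed

lemma clairvoyant_value_attained:
  assumes D: "product_line_problem D"
    and "t < horizon D"
  obtains A where "A \<in> assortments D"
    "clairvoyant_value D \<omega> (horizon D - t) x = measure_pmf.expectation (sales_pmf D \<omega> t A x)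
      (\<lambda>X. sales_value D X + clairvoyant_value D \<omega> (horizon D - Suc t) (\<lambda>i. x i - X i))"
proof -
  have n: "horizon D - t = Suc (horizon D - Suc t)" "horizon D - Suc (horizon D - Suc t) = t"
    using assms by auto
  let ?F = "\<lambda>A. measure_pmf.expectation (sales_pmf D \<omega> t A x)
      (\<lambda>X. sales_value D X + clairvoyant_value D \<omega> (horizon D - Suc t) (\<lambda>i. x i - X i))"
  have "Max (?F ` assortments D) \<in> ?F ` assortments D"
    using finite_assortments[OF D] assortments_nonempty by (intro Max_in) auto
  then obtain A where A: "Max (?F ` assortments D) = ?F A" "A \<in> assortments D"
    by (rule imageE)
  have "clairvoyant_value D \<omega> (horizon D - t) x = Max (?F ` assortments D)"
    unfolding n(1) clairvoyant_value.simps n(2) ..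
  from A(2) trans[OF this A(1)] show ?thesis by (rule that)
qed

text \<open>
  Both bounds come from offering the two systems the same assortment and coupling their purchases:
  either the extra consumer of segment \<open>j\<close> buys now, for \<open>price D j\<close>, and the systems merge, or the
  extra consumer stays and the bounds for the remaining epochs apply.
\<close>

lemma clairvoyant_value_add_one:
  assumes D: "product_line_problem D"
    and \<omega>: "\<omega> \<in> space (exo D)" and j: "j \<in> segments D" and "n \<le> horizon D"
  shows "clairvoyant_value D \<omega> n x \<le> clairvoyant_value D \<omega> n (x(j := Suc (x j))) \<and>
    clairvoyant_value D \<omega> n (x(j := Suc (x j))) \<le> clairvoyant_value D \<omega> n x + price D j"
  using \<open>n \<le> horizon D\<close>
proof (induction n arbitrary: x)
  case 0
  then show ?case using price_nonneg[OF D j] by simp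
next
  case (Suc n)
  define t where "t = horizon D - Suc n"
  have t: "t < horizon D" "horizon D - t = Suc n" "horizon D - Suc t = n"
    using Suc.prems by (auto simp: t_def)
  let ?y = "x(j := Suc (x j))"
  let ?V = "clairvoyant_value D \<omega> n"
  let ?G = "\<lambda>A z. measure_pmf.expectation (sales_pmf D \<omega> t A z)
    (\<lambda>X. sales_value D X + ?V (\<lambda>i. z i - X i))"
  have IH: "?V x \<le> ?V (x(j := Suc (x j)))" "?V (x(j := Suc (x j))) \<le> ?V x + price D j" for x
    using Suc.IH[of x] Suc_leD[OF Suc.prems] by blast+
  have step: "?G A x \<le> ?G A ?y \<and> ?G A ?y \<le> ?G A x + price D j" if A: "A \<in> assortments D" for A
  proof -
    let ?q = "purchase_prob D t j A \<omega>"
    let ?M = "sales_pmf D \<omega> t A x"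
    note q = purchase_prob_range[OF D t(1) A \<omega> j]
    have int: "integrable (measure_pmf ?M) f" for f :: "_ \<Rightarrow> real"
      by (rule integrable_sales[OF D t(1) A \<omega>])
    have Gy: "?G A ?y = measure_pmf.expectation ?M
        (\<lambda>X. sales_value D X + (?q * (price D j + ?V (\<lambda>i. x i - X i)) +
          (1 - ?q) * ?V ((\<lambda>i. x i - X i)(j := Suc (x j - X j)))))"
      unfolding expectation_sales_Suc[OF D t(1) A \<omega> j]
    proof (rule expectation_cong_pmf)
      fix X assume X: "X \<in> set_pmf ?M"
      have 1: "(\<lambda>i. ?y i - (X(j := Suc (X j))) i) = (\<lambda>i. x i - X i)"
        by auto
      have 2: "(\<lambda>i. ?y i - X i) = (\<lambda>i. x i - X i)(j := Suc (x j - X j))"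
        using sales_le[OF D t(1) A \<omega> X, of j] by (auto simp: fun_eq_iff Suc_diff_le)
      show "?q * (sales_value D (X(j := Suc (X j))) + ?V (\<lambda>i. ?y i - (X(j := Suc (X j))) i)) +
          (1 - ?q) * (sales_value D X + ?V (\<lambda>i. ?y i - X i)) =
        sales_value D X + (?q * (price D j + ?V (\<lambda>i. x i - X i)) +
          (1 - ?q) * ?V ((\<lambda>i. x i - X i)(j := Suc (x j - X j))))"
        unfolding 1 2 by (simp add: sales_value_upd[OF D j] algebra_simps)
    qed
    \<comment> \<open>Here \<open>v\<close> and \<open>w\<close> are the continuation values without and with the extra consumer.\<close>
    have lower: "v \<le> ?q * (price D j + v) + (1 - ?q) * w"
      and upper: "?q * (price D j + v) + (1 - ?q) * w \<le> v + price D j"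
      if "v \<le> w" "w \<le> v + price D j" for v w :: real
    proof -
      have "v = ?q * v + (1 - ?q) * v" by (simp add: algebra_simps)
      also have "\<dots> \<le> ?q * (price D j + v) + (1 - ?q) * w"
        using q that price_nonneg[OF D j] by (intro add_mono mult_left_mono) auto
      finally show "v \<le> ?q * (price D j + v) + (1 - ?q) * w" .
      have "?q * (price D j + v) + (1 - ?q) * w
          \<le> ?q * (price D j + v) + (1 - ?q) * (v + price D j)"
        using q that by (intro add_mono mult_left_mono) auto
      also have "\<dots> = v + price D j" by (simp add: algebra_simps)
      finally show "?q * (price D j + v) + (1 - ?q) * w \<le> v + price D j" .
    qed
    have "?G A x \<le> ?G A ?y"
      unfolding Gy
      by (intro expectation_mono_finite[OF finite_set_sales[OF D t(1) A \<omega>]] add_left_mono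
          lower IH(1,2)[of "\<lambda>i. x i - X i" for X])
    moreover have "?G A ?y \<le> measure_pmf.expectation ?M
        (\<lambda>X. sales_value D X + (?V (\<lambda>i. x i - X i) + price D j))"
      unfolding Gy
      by (intro expectation_mono_finite[OF finite_set_sales[OF D t(1) A \<omega>]] add_left_mono
          upper IH(1,2)[of "\<lambda>i. x i - X i" for X])
    then have "?G A ?y \<le> ?G A x + price D j"
      unfolding add.assoc[symmetric] using int by (subst (asm) Bochner_Integration.integral_add) auto
    ultimately show ?thesis by (rule conjI)
  qed
  obtain A where A: "A \<in> assortments D" "clairvoyant_value D \<omega> (Suc n) x = ?G A x"
    by (rule clairvoyant_value_attained[OF D t(1), of \<omega> x, unfolded t(2,3)])
  obtain B where B: "B \<in> assortments D" "clairvoyant_value D \<omega> (Suc n) ?y = ?G B ?y"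
    by (rule clairvoyant_value_attained[OF D t(1), of \<omega> ?y, unfolded t(2,3)])
  have "?G A ?y \<le> clairvoyant_value D \<omega> (Suc n) ?y"
    using clairvoyant_value_ge[OF D t(1) A(1), of \<omega> ?y] unfolding t .
  moreover have "?G B x \<le> clairvoyant_value D \<omega> (Suc n) x"
    using clairvoyant_value_ge[OF D t(1) B(1), of \<omega> x] unfolding t .
  ultimately show ?case
    using step[OF A(1)] step[OF B(1)] A(2) B(2) by linarith
qed

lemma clairvoyant_value_add:
  assumes D: "product_line_problem D"
    and \<omega>: "\<omega> \<in> space (exo D)" and n: "n \<le> horizon D"
    and X: "\<And>i. i \<notin> segments D \<Longrightarrow> X i = 0"
  shows "clairvoyant_value D \<omega> n y \<le> clairvoyant_value D \<omega> n (\<lambda>i. y i + X i) \<and>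
    clairvoyant_value D \<omega> n (\<lambda>i. y i + X i) \<le> clairvoyant_value D \<omega> n y + sales_value D X"
  using X
proof (induction "\<Sum>i\<in>segments D. X i" arbitrary: X)
  case 0
  then have "X i = 0" for i
    using finite_segments[OF D] by (cases "i \<in> segments D") auto
  then show ?case by (simp add: sales_value_def)
next
  case (Suc m)
  then obtain j where j: "j \<in> segments D" "X j \<noteq> 0"
    using finite_segments[OF D] by (metis nat.distinct(1) sum.neutral)
  define Z where "Z = X(j := X j - 1)"
  have XZ: "X = Z(j := Suc (Z j))" using j by (auto simp: Z_def)
  have "(\<Sum>i\<in>segments D. X i) = Suc (\<Sum>i\<in>segments D. Z i)"
    using finite_segments[OF D] j unfolding XZ by (simp add: sum.remove)
  then have "m = (\<Sum>i\<in>segments D. Z i)" using Suc.hyps(2) by simp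
  moreover have "Z i = 0" if "i \<notin> segments D" for i
    using Suc.prems[OF that] by (auto simp: Z_def)
  ultimately have IH: "clairvoyant_value D \<omega> n y \<le> clairvoyant_value D \<omega> n (\<lambda>i. y i + Z i)"
    "clairvoyant_value D \<omega> n (\<lambda>i. y i + Z i) \<le> clairvoyant_value D \<omega> n y + sales_value D Z"
    using Suc.hyps(1) by auto
  have eq: "(\<lambda>i. y i + X i) = (\<lambda>i. y i + Z i)(j := Suc (y j + Z j))"
    unfolding XZ by auto
  have "sales_value D X = sales_value D Z + price D j"
    unfolding XZ by (simp add: sales_value_upd[OF D j(1)])
  then show ?case
    using clairvoyant_value_add_one[OF D \<omega> j(1) n, of "\<lambda>i. y i + Z i"] IH unfolding eq by auto
qed

lemma clairvoyant_value_after_sales: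
  assumes D: "product_line_problem D"
    and \<omega>: "\<omega> \<in> space (exo D)" and n: "n \<le> horizon D"
    and t: "t < horizon D" and A: "A \<in> assortments D"
    and X: "X \<in> set_pmf (sales_pmf D \<omega> t A x)"
  shows "clairvoyant_value D \<omega> n (\<lambda>i. x i - X i) \<le> clairvoyant_value D \<omega> n x"
    and "clairvoyant_value D \<omega> n x \<le> clairvoyant_value D \<omega> n (\<lambda>i. x i - X i) + sales_value D X"
  using clairvoyant_value_add[of D \<omega> n X "\<lambda>i. x i - X i", OF D \<omega> n sales_outside[OF D t A \<omega> X]]
    sales_le[OF D t A \<omega> X] by auto

text \<open>
  Each consumer buys at most once.  This gives a bound on revenue that does not depend on \<open>\<omega>\<close>, as
  integrability requires.
\<close>

lemma clairvoyant_value_le_sales_value: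
  assumes D: "product_line_problem D"
    and \<omega>: "\<omega> \<in> space (exo D)" and n: "n \<le> horizon D"
  shows "clairvoyant_value D \<omega> n x \<le> sales_value D x"
  using n
proof (induction n arbitrary: x)
  case 0
  then show ?case using sales_value_nonneg[OF D] by simp
next
  case (Suc n)
  define t where "t = horizon D - Suc n"
  have t: "t < horizon D" "horizon D - t = Suc n" "horizon D - Suc t = n"
    using Suc.prems by (auto simp: t_def)
  obtain A where A: "A \<in> assortments D" "clairvoyant_value D \<omega> (Suc n) x =
      measure_pmf.expectation (sales_pmf D \<omega> t A x)
        (\<lambda>X. sales_value D X + clairvoyant_value D \<omega> n (\<lambda>i. x i - X i))"
    by (rule clairvoyant_value_attained[OF D t(1), of \<omega> x, unfolded t(2,3)])
  have "clairvoyant_value D \<omega> (Suc n) x \<le>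
      measure_pmf.expectation (sales_pmf D \<omega> t A x) (\<lambda>_. sales_value D x)"
    unfolding A(2)
  proof (rule expectation_mono_finite[OF finite_set_sales[OF D t(1) A(1) \<omega>]])
    fix X assume X: "X \<in> set_pmf (sales_pmf D \<omega> t A x)"
    have "clairvoyant_value D \<omega> n (\<lambda>i. x i - X i) \<le> sales_value D (\<lambda>i. x i - X i)"
      using Suc by simp
    also have "\<dots> = sales_value D x - sales_value D X"
      using sales_le[OF D t(1) A(1) \<omega> X]
      by (simp add: sales_value_def of_nat_diff right_diff_distrib sum_subtractf)
    finally show "sales_value D X + clairvoyant_value D \<omega> n (\<lambda>i. x i - X i) \<le> sales_value D x"
      by simp
  qed
  then show ?case by simp
qed

text \<open>
  The greedy exchange.  Replace the clairvoyant's current assortment by a myopic one \<open>A\<close>: the current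
  revenue does not drop, and the sales \<open>X\<close> made under \<open>A\<close> reduce the continuation value by at most
  their own revenue, so that the loss is covered by counting the myopic revenue twice.
\<close>

lemma clairvoyant_value_le_myopic_step:
  assumes D: "product_line_problem D"
    and \<omega>: "\<omega> \<in> space (exo D)" and t: "t < horizon D"
    and myopic: "is_arg_max
      (\<lambda>A. \<Sum>i\<in>segments D. price D i * real (x i) * purchase_prob D t i A \<omega>)
      (\<lambda>A. A \<in> assortments D) A"
  shows "clairvoyant_value D \<omega> (horizon D - t) x \<le> measure_pmf.expectation (sales_pmf D \<omega> t A x)
    (\<lambda>X. 2 * sales_value D X + clairvoyant_value D \<omega> (horizon D - Suc t) (\<lambda>i. x i - X i))"
proof -
  let ?V = "clairvoyant_value D \<omega> (horizon D - Suc t)"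
  let ?E = "\<lambda>A. measure_pmf.expectation (sales_pmf D \<omega> t A x)"
  have A: "A \<in> assortments D" using myopic by (simp add: is_arg_max_def)
  obtain B where B: "B \<in> assortments D"
    "clairvoyant_value D \<omega> (horizon D - t) x = ?E B (\<lambda>X. sales_value D X + ?V (\<lambda>i. x i - X i))"
    by (rule clairvoyant_value_attained[OF D t, of \<omega> x])
  note V = clairvoyant_value_after_sales[OF D \<omega> _ t, of "horizon D - Suc t", simplified]
  have "?E B (\<lambda>X. sales_value D X + ?V (\<lambda>i. x i - X i)) \<le> ?E B (\<lambda>X. sales_value D X + ?V x)"
    by (intro expectation_mono_finite[OF finite_set_sales[OF D t B(1) \<omega>]] add_left_mono V(1)[OF B(1)])
  also have "\<dots> = ?E B (sales_value D) + ?V x"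
    using integrable_sales[OF D t B(1) \<omega>] by (subst Bochner_Integration.integral_add) auto
  also have "\<dots> \<le> ?E A (sales_value D) + ?V x"
    unfolding expectation_sales_value[OF D t A \<omega>] expectation_sales_value[OF D t B(1) \<omega>]
    using myopic B(1) by (auto simp: is_arg_max_def not_less)
  also have "\<dots> = ?E A (\<lambda>X. sales_value D X + ?V x)"
    using integrable_sales[OF D t A \<omega>] by (subst Bochner_Integration.integral_add) auto
  also have "\<dots> \<le> ?E A (\<lambda>X. 2 * sales_value D X + ?V (\<lambda>i. x i - X i))"
  proof (rule expectation_mono_finite[OF finite_set_sales[OF D t A \<omega>]])
    fix X assume "X \<in> set_pmf (sales_pmf D \<omega> t A x)"
    from V(2)[OF A this]
    show "sales_value D X + ?V x \<le> 2 * sales_value D X + ?V (\<lambda>i. x i - X i)" by simp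
  qed
  finally show ?thesis using B(2) by simp
qed

section \<open>Policies at a fixed exogenous outcome\<close>

lemma space_info:
  assumes D: "product_line_problem D"
  shows "space (info D t) = space (exo D)"
  using D by (auto simp: product_line_problem_def subalgebra_def)

lemma adaptive_policy_range:
  assumes D: "product_line_problem D"
    and "adaptive_policy D \<tau>" "t < horizon D" "\<omega> \<in> space (exo D)"
  shows "\<tau> t h \<omega> \<in> assortments D"
proof -
  have "\<tau> t h \<in> info D t \<rightarrow>\<^sub>M count_space (assortments D)"
    using assms by (simp add: adaptive_policy_def)
  from measurable_space[OF this] show ?thesis using assms space_info[OF D] by simp
qed

lemma finite_set_history:
  assumes D: "product_line_problem D"
    and \<tau>: "adaptive_policy D \<tau>" and \<omega>: "\<omega> \<in> space (exo D)" and "t \<le> horizon D"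
  shows "finite (set_pmf (history_pmf D \<tau> \<omega> t))"
  using \<open>t \<le> horizon D\<close>
proof (induction t)
  case (Suc t)
  then show ?case
    using finite_set_sales[OF D _ adaptive_policy_range[OF D \<tau>] \<omega>] \<omega> by auto
qed simp

lemma expectation_history_Suc:
  fixes f :: "('a, 's) history \<Rightarrow> real"
  assumes D: "product_line_problem D"
    and \<tau>: "adaptive_policy D \<tau>" and \<omega>: "\<omega> \<in> space (exo D)" and t: "t < horizon D"
  shows "measure_pmf.expectation (history_pmf D \<tau> \<omega> (Suc t)) f =
    measure_pmf.expectation (history_pmf D \<tau> \<omega> t) (\<lambda>h.
      measure_pmf.expectation (sales_pmf D \<omega> t (\<tau> t h \<omega>) (size_after D h))
        (\<lambda>X. f (h @ [(\<tau> t h \<omega>, X)])))"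
  unfolding history_pmf.simps
  using finite_set_history[OF D \<tau> \<omega>, of t] finite_set_sales[OF D t adaptive_policy_range[OF D \<tau> t \<omega>] \<omega>] t
  by (subst expectation_bind_finite) auto

section \<open>Averaging over the exogenous randomness\<close>

lemma measurable_exoI:
  assumes "product_line_problem D" and "f \<in> info D t \<rightarrow>\<^sub>M N"
  shows "f \<in> exo D \<rightarrow>\<^sub>M N"
  using assms by (auto simp: product_line_problem_def intro: measurable_from_subalg)

lemma measurable_expectation_sales:
  fixes f :: "'w \<Rightarrow> ('s \<Rightarrow> nat) \<Rightarrow> real"
  assumes D: "product_line_problem D"
    and t: "t < horizon D" and A: "A \<in> assortments D"
    and f: "\<And>X. (\<lambda>\<omega>. f \<omega> X) \<in> borel_measurable (exo D)"
  shows "(\<lambda>\<omega>. measure_pmf.expectation (sales_pmf D \<omega> t A x) (f \<omega>)) \<in> borel_measurable (exo D)"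
proof -
  let ?S = "PiE_dflt (segments D) 0 (\<lambda>i. {..x i})"
  have "(\<lambda>\<omega>. purchase_prob D t i A \<omega>) \<in> borel_measurable (exo D)" if "i \<in> segments D" for i
    using D that t A unfolding product_line_problem_def by (intro measurable_exoI[OF D, of _ t]) blast
  note [measurable] = this f
  have "measure_pmf.expectation (sales_pmf D \<omega> t A x) (f \<omega>) =
      (\<Sum>X\<in>?S. f \<omega> X * (\<Prod>i\<in>segments D. real (x i choose X i) *
        purchase_prob D t i A \<omega> ^ X i * (1 - purchase_prob D t i A \<omega>) ^ (x i - X i)))"
    if \<omega>: "\<omega> \<in> space (exo D)" for \<omega>
  proof -
    have "measure_pmf.expectation (sales_pmf D \<omega> t A x) (f \<omega>) =
        (\<Sum>X\<in>?S. f \<omega> X * pmf (sales_pmf D \<omega> t A x) X)"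
      using set_sales_subset[OF D t A \<omega>]
      by (intro integral_measure_pmf_real finite_PiE_dflt finite_segments[OF D]) auto
    also have "\<dots> = (\<Sum>X\<in>?S. f \<omega> X * (\<Prod>i\<in>segments D. real (x i choose X i) *
        purchase_prob D t i A \<omega> ^ X i * (1 - purchase_prob D t i A \<omega>) ^ (x i - X i)))"
      unfolding sales_pmf_def using purchase_prob_range[OF D t A \<omega>]
      by (intro sum.cong refl arg_cong2[where f = "(*)"])
        (auto simp: PiE_dflt_def pmf_Pi' finite_segments[OF D] intro!: prod.cong)
    finally show ?thesis .
  qed
  then show ?thesis
    by (subst measurable_cong) (assumption, measurable)
qed

text \<open>
  The integrand may itself depend on \<open>\<omega>\<close>, because the step from \<open>t\<close> to \<open>Suc t\<close> replaces a function of
  the history by its conditional expectation over the sales of epoch \<open>t\<close>.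
\<close>

lemma measurable_expectation_history:
  fixes f :: "'w \<Rightarrow> ('a, 's) history \<Rightarrow> real"
  assumes D: "product_line_problem D"
    and \<tau>: "adaptive_policy D \<tau>" and "t \<le> horizon D"
    and "\<And>h. (\<lambda>\<omega>. f \<omega> h) \<in> borel_measurable (exo D)"
  shows "(\<lambda>\<omega>. measure_pmf.expectation (history_pmf D \<tau> \<omega> t) (f \<omega>)) \<in> borel_measurable (exo D)"
  using assms(3,4)
proof (induction t arbitrary: f)
  case (Suc t)
  from Suc.prems(1) have t: "t < horizon D" by simp
  let ?g = "\<lambda>\<omega> h A. measure_pmf.expectation (sales_pmf D \<omega> t A (size_after D h))
    (\<lambda>X. f \<omega> (h @ [(A, X)]))"
  have g: "(\<lambda>\<omega>. ?g \<omega> h (\<tau> t h \<omega>)) \<in> borel_measurable (exo D)" for h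
  proof -
    have \<tau>_meas: "\<tau> t h \<in> exo D \<rightarrow>\<^sub>M count_space (assortments D)"
      using \<tau> t by (intro measurable_exoI[OF D, of _ t]) (simp add: adaptive_policy_def)
    have "?g \<omega> h (\<tau> t h \<omega>) =
        (\<Sum>A\<in>assortments D. indicator (\<tau> t h -` {A} \<inter> space (exo D)) \<omega> * ?g \<omega> h A)"
      if \<omega>: "\<omega> \<in> space (exo D)" for \<omega>
    proof -
      have "(\<Sum>A\<in>assortments D. indicator (\<tau> t h -` {A} \<inter> space (exo D)) \<omega> * ?g \<omega> h A) =
          (\<Sum>A\<in>assortments D. if \<tau> t h \<omega> = A then ?g \<omega> h A else 0)"
        using \<omega> by (intro sum.cong refl) (simp add: indicator_def)
      then show ?thesis
        by (simp only: sum.delta'[OF finite_assortments[OF D]]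
            adaptive_policy_range[OF D \<tau> t \<omega>] if_True)
    qed
    moreover have "(\<lambda>\<omega>. \<Sum>A\<in>assortments D.
        indicator (\<tau> t h -` {A} \<inter> space (exo D)) \<omega> * ?g \<omega> h A) \<in> borel_measurable (exo D)"
    proof (intro borel_measurable_sum borel_measurable_times borel_measurable_indicator)
      fix A assume A: "A \<in> assortments D"
      show "\<tau> t h -` {A} \<inter> space (exo D) \<in> sets (exo D)"
        using A by (intro measurable_sets[OF \<tau>_meas]) auto
      show "(\<lambda>\<omega>. ?g \<omega> h A) \<in> borel_measurable (exo D)"
        by (intro measurable_expectation_sales[OF D t A] Suc.prems)
    qed
    ultimately show ?thesis
      by (subst measurable_cong) assumption+
  qed
  have "(\<lambda>\<omega>. measure_pmf.expectation (history_pmf D \<tau> \<omega> t) (\<lambda>h. ?g \<omega> h (\<tau> t h \<omega>)))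
      \<in> borel_measurable (exo D)"
    using t g by (intro Suc.IH) auto
  then show ?case
    by (subst measurable_cong[OF expectation_history_Suc[OF D \<tau> _ t]])
qed simp

theorem mainTheorem12:
  fixes D :: "('w, 'a, 's) product_line" and \<sigma> :: "('w, 'a, 's) policy"
  assumes "product_line_problem D"
    and "myopic_policy D \<sigma>"
  shows "expected_revenue D \<sigma> \<ge> optimal_revenue D / 2"
proof -
  note D = assms(1)
  have ad: "adaptive_policy D \<sigma>"
    using assms(2) by (simp add: myopic_policy_def)
  have upper: "measure_pmf.expectation (history_pmf D \<tau> \<omega> (horizon D)) (revenue D)
      \<le> clairvoyant_value D \<omega> (horizon D) (init_size D)"
    if \<tau>: "adaptive_policy D \<tau>" and \<omega>: "\<omega> \<in> space (exo D)" for \<tau> \<omega>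
  proof -
    \<comment> \<open>The expectation of the revenue so far plus the value of the remaining epochs is nonincreasing.\<close>
    have "measure_pmf.expectation (history_pmf D \<tau> \<omega> t)
        (\<lambda>h. revenue D h + clairvoyant_value D \<omega> (horizon D - t) (size_after D h))
      \<le> clairvoyant_value D \<omega> (horizon D) (init_size D)" if "t \<le> horizon D" for t
      using that
    proof (induction t)
      case (Suc t)
      from Suc.prems have t: "t < horizon D" by simp
      let ?V = "clairvoyant_value D \<omega> (horizon D - Suc t)"
      have "measure_pmf.expectation (history_pmf D \<tau> \<omega> (Suc t))
          (\<lambda>h. revenue D h + ?V (size_after D h))
        \<le> measure_pmf.expectation (history_pmf D \<tau> \<omega> t)
          (\<lambda>h. revenue D h + clairvoyant_value D \<omega> (horizon D - t) (size_after D h))"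
        unfolding expectation_history_Suc[OF D \<tau> \<omega> t]
      proof (rule expectation_mono_finite)
        show "finite (set_pmf (history_pmf D \<tau> \<omega> t))"
          using t by (intro finite_set_history[OF D \<tau> \<omega>]) simp
        fix h
        note A = adaptive_policy_range[OF D \<tau> t \<omega>, of h]
        let ?M = "sales_pmf D \<omega> t (\<tau> t h \<omega>) (size_after D h)"
        have "measure_pmf.expectation ?M (\<lambda>X. revenue D (h @ [(\<tau> t h \<omega>, X)]) +
              ?V (size_after D (h @ [(\<tau> t h \<omega>, X)]))) =
            revenue D h + measure_pmf.expectation ?M
              (\<lambda>X. sales_value D X + ?V (\<lambda>i. size_after D h i - X i))"
          using integrable_sales[OF D t A \<omega>] by (simp add: add.assoc)
        then show "measure_pmf.expectation ?M (\<lambda>X. revenue D (h @ [(\<tau> t h \<omega>, X)]) +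
              ?V (size_after D (h @ [(\<tau> t h \<omega>, X)]))) \<le>
            revenue D h + clairvoyant_value D \<omega> (horizon D - t) (size_after D h)"
          using clairvoyant_value_ge[OF D t A] by simp
      qed
      from this Suc.IH[OF less_imp_le[OF t]] show ?case by (rule order_trans)
    qed simp
    from this[of "horizon D"] show ?thesis by simp
  qed
  have lower: "clairvoyant_value D \<omega> (horizon D) (init_size D)
      \<le> 2 * measure_pmf.expectation (history_pmf D \<sigma> \<omega> (horizon D)) (revenue D)"
    if \<omega>: "\<omega> \<in> space (exo D)" for \<omega>
  proof -
    \<comment> \<open>With the revenue counted twice, the same expectation is nondecreasing.\<close>
    have "clairvoyant_value D \<omega> (horizon D) (init_size D) \<le>
      measure_pmf.expectation (history_pmf D \<sigma> \<omega> t)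
        (\<lambda>h. 2 * revenue D h + clairvoyant_value D \<omega> (horizon D - t) (size_after D h))"
      if "t \<le> horizon D" for t
      using that
    proof (induction t)
      case (Suc t)
      from Suc.prems have t: "t < horizon D" by simp
      let ?V = "clairvoyant_value D \<omega> (horizon D - Suc t)"
      have "measure_pmf.expectation (history_pmf D \<sigma> \<omega> t)
          (\<lambda>h. 2 * revenue D h + clairvoyant_value D \<omega> (horizon D - t) (size_after D h))
        \<le> measure_pmf.expectation (history_pmf D \<sigma> \<omega> (Suc t))
          (\<lambda>h. 2 * revenue D h + ?V (size_after D h))"
        unfolding expectation_history_Suc[OF D ad \<omega> t]
      proof (rule expectation_mono_finite)
        show "finite (set_pmf (history_pmf D \<sigma> \<omega> t))"
          using t by (intro finite_set_history[OF D ad \<omega>]) simp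
        fix h assume h: "h \<in> set_pmf (history_pmf D \<sigma> \<omega> t)"
        note A = adaptive_policy_range[OF D ad t \<omega>, of h]
        let ?M = "sales_pmf D \<omega> t (\<sigma> t h \<omega>) (size_after D h)"
        have "measure_pmf.expectation ?M (\<lambda>X. 2 * revenue D (h @ [(\<sigma> t h \<omega>, X)]) +
              ?V (size_after D (h @ [(\<sigma> t h \<omega>, X)]))) =
            2 * revenue D h + measure_pmf.expectation ?M
              (\<lambda>X. 2 * sales_value D X + ?V (\<lambda>i. size_after D h i - X i))"
          using integrable_sales[OF D t A \<omega>] by (simp add: add.assoc)
        moreover have "is_arg_max (\<lambda>A. \<Sum>i\<in>segments D.
              price D i * real (size_after D h i) * purchase_prob D t i A \<omega>)
            (\<lambda>A. A \<in> assortments D) (\<sigma> t h \<omega>)"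
          using assms(2) t \<omega> h by (simp add: myopic_policy_def)
        ultimately show "2 * revenue D h + clairvoyant_value D \<omega> (horizon D - t) (size_after D h) \<le>
            measure_pmf.expectation ?M (\<lambda>X. 2 * revenue D (h @ [(\<sigma> t h \<omega>, X)]) +
              ?V (size_after D (h @ [(\<sigma> t h \<omega>, X)])))"
          using clairvoyant_value_le_myopic_step[OF D \<omega> t] by simp
      qed
      from Suc.IH[OF less_imp_le[OF t]] this show ?case by (rule order_trans)
    qed simp
    from this[of "horizon D"] show ?thesis by simp
  qed
  have integrable: "integrable (exo D)
      (\<lambda>\<omega>. measure_pmf.expectation (history_pmf D \<tau> \<omega> (horizon D)) (revenue D))"
    if \<tau>: "adaptive_policy D \<tau>" for \<tau>
  proof -
    interpret prob_space "exo D"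
      using D by (simp add: product_line_problem_def)
    have "norm (measure_pmf.expectation (history_pmf D \<tau> \<omega> (horizon D)) (revenue D))
        \<le> sales_value D (init_size D)" if \<omega>: "\<omega> \<in> space (exo D)" for \<omega>
    proof -
      have "0 \<le> measure_pmf.expectation (history_pmf D \<tau> \<omega> (horizon D)) (revenue D)"
        by (intro Bochner_Integration.integral_nonneg revenue_nonneg[OF D])
      moreover have "measure_pmf.expectation (history_pmf D \<tau> \<omega> (horizon D)) (revenue D)
          \<le> sales_value D (init_size D)"
        using upper[OF \<tau> \<omega>] clairvoyant_value_le_sales_value[OF D \<omega> order_refl] by (rule order_trans)
      ultimately show ?thesis by simp
    qed
    then show ?thesis
      by (intro integrable_const_bound[where B = "sales_value D (init_size D)"]
          measurable_expectation_history[OF D \<tau>]) auto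
  qed
  have "expected_revenue D \<tau> \<le> 2 * expected_revenue D \<sigma>"
    if \<tau>: "adaptive_policy D \<tau>" for \<tau>
  proof -
    have "expected_revenue D \<tau> \<le> (LINT \<omega>|exo D.
        2 * measure_pmf.expectation (history_pmf D \<sigma> \<omega> (horizon D)) (revenue D))"
      unfolding expected_revenue_def
      using integrable[OF \<tau>] integrable[OF ad] order_trans[OF upper[OF \<tau>] lower]
      by (intro integral_mono) auto
    also have "\<dots> = 2 * expected_revenue D \<sigma>"
      by (simp add: expected_revenue_def)
    finally show ?thesis .
  qed
  then have "optimal_revenue D \<le> 2 * expected_revenue D \<sigma>"
    unfolding optimal_revenue_def using ad by (intro cSUP_least) auto
  then show ?thesis by simp
qed

end
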